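(* Let $\langle A,\succ,1\rangle$ be a distributive bounded G-algebra with least element $0$. Define $x\vee y=(x\succ y)\succ y$, $\sim x=x\succ 0$ and $x\wedge y=\sim(\sim x\vee\sim y)$. Then $\langle A,\vee,\wedge,\sim,1\rangle$ is a De Morgan algebra, i.e. $(A,\vee,\wedge)$ is a distributive lattice with greatest element $1$, $\sim\sim x=x$ and $\sim(x\vee y)=\sim x\wedge\sim y$ for all $x,y\in A$.
   Context: A G-algebra is an algebra $\langle A,\succ,1\rangle$ of type $(2,0)$ satisfying for all $x,y,z$: (G1) $1\succ x=x$; (G2) $x\succ 1=1$; (G3) $(x\succ y)\succ y=(y\succ x)\succ x$; (G4) if $x\succ(y\succ z)=1$ then $y\succ(x\succ z)=1$. The relation $x\leq y$ iff $x\succ y=1$ is a partial order. A G-algebra is bounded if there is $0\in A$ with $0\leq x$ for all $x$. A bounded G-algebra is distributive if for all $x,y,z$: $(x\wedge y)\succ z\leq (x\succ z)\vee(y\succ z)$, where $\vee,\wedge$ are as defined in the claim. *)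

theory Defs
  imports Main
begin

locale g_algebra =
  fixes imp :: "'a \<Rightarrow> 'a \<Rightarrow> 'a"  (infixr \<open>\<succ>\<close> 70)
    and one :: 'a  (\<open>\<one>\<close>)
  assumes G1: "\<one> \<succ> x = x"
    and G2: "x \<succ> \<one> = \<one>"
    and G3: "(x \<succ> y) \<succ> y = (y \<succ> x) \<succ> x"
    and G4: "x \<succ> (y \<succ> z) = \<one> \<Longrightarrow> y \<succ> (x \<succ> z) = \<one>"
begin

definition le :: "'a \<Rightarrow> 'a \<Rightarrow> bool"  (infix \<open>\<preceq>\<close> 50)
  where "x \<preceq> y \<longleftrightarrow> x \<succ> y = \<one>"

definition join :: "'a \<Rightarrow> 'a \<Rightarrow> 'a"  (infixl \<open>\<squnion>\<close> 65)
  where "x \<squnion> y = (x \<succ> y) \<succ> y"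

end

locale bounded_g_algebra = g_algebra +
  fixes zero :: 'a  (\<open>\<zero>\<close>)
  assumes zero_least: "\<zero> \<preceq> x"
begin

definition neg :: "'a \<Rightarrow> 'a"  (\<open>\<sim> _\<close> [81] 80)
  where "\<sim> x = x \<succ> \<zero>"

definition meet :: "'a \<Rightarrow> 'a \<Rightarrow> 'a"  (infixl \<open>\<sqinter>\<close> 68)
  where "x \<sqinter> y = \<sim> (\<sim> x \<squnion> \<sim> y)"

end

locale distributive_bounded_g_algebra = bounded_g_algebra +
  assumes distributive: "(x \<sqinter> y) \<succ> z \<preceq> (x \<succ> z) \<squnion> (y \<succ> z)"

text \<open>
  The signature of a De Morgan algebra contains no order; the library's lattice predicates
  are instantiated with the order induced by the join, \<open>x \<le> y\<close> iff \<open>x \<squnion> y = y\<close>.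
\<close>

definition de_morgan_algebra ::
    "('a \<Rightarrow> 'a \<Rightarrow> 'a) \<Rightarrow> ('a \<Rightarrow> 'a \<Rightarrow> 'a) \<Rightarrow> ('a \<Rightarrow> 'a) \<Rightarrow> 'a \<Rightarrow> bool"
  where "de_morgan_algebra join meet neg one \<longleftrightarrow>
    (let le = (\<lambda>x y. join x y = y); less = (\<lambda>x y. le x y \<and> x \<noteq> y)
     in class.distrib_lattice meet le less join \<and> class.order_top le less one) \<and>
    (\<forall>x. neg (neg x) = x) \<and>
    (\<forall>x y. neg (join x y) = meet (neg x) (neg y))"

end

theory Submission
  imports Defs
begin

text \<open>
  For fixed \<open>z\<close>, axiom (G4) says that \<open>u \<mapsto> u \<succ> z\<close> is an antitone Galois connection of the
  algebra with itself, whose closure operator is \<open>u \<mapsto> u \<squnion> z\<close>. This makes \<open>\<squnion>\<close> a supremum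
  and, at \<open>z = \<zero>\<close>, makes \<open>\<sim>\<close> an antitone involution, so that \<open>\<sqinter>\<close> is an infimum. The
  connection turns suprema into infima, and the distributivity axiom says that it also turns
  infima into suprema. Hence the closure operator \<open>u \<mapsto> u \<squnion> z\<close> preserves infima, which is
  lattice distributivity.
\<close>

context g_algebra
begin

text \<open>\<open>G3\<close> at \<open>\<one>\<close> and \<open>x\<close> gives \<open>x \<succ> x
  = (\<one> \<succ> x) \<succ> x = (x \<succ> \<one>) \<succ> \<one> = \<one>\<close>.\<close>

lemma le_refl: "x \<preceq> x"
  by (metis le_def G1 G2 G3)

lemma le_one: "x \<preceq> \<one>"
  by (simp add: le_def G2)

lemma le_imp_swap: "x \<preceq> y \<succ> z \<longleftrightarrow> y \<preceq> x \<succ> z"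
  unfolding le_def using G4 by blast

lemma join_commute: "x \<squnion> y = y \<squnion> x"
  unfolding join_def by (rule G3)

lemma join_upper1: "x \<preceq> x \<squnion> y"
  unfolding join_def using le_imp_swap le_refl by blast

lemma join_upper2: "y \<preceq> x \<squnion> y"
  by (metis join_upper1 join_commute)

lemma le_iff_join: "x \<preceq> y \<longleftrightarrow> x \<squnion> y = y"
  by (metis join_upper1 join_def le_def G1)

lemma le_antisym: "x \<preceq> y \<Longrightarrow> y \<preceq> x \<Longrightarrow> x = y"
  by (metis le_iff_join join_commute)

lemma le_trans:
  assumes "x \<preceq> y" and "y \<preceq> z"
  shows "x \<preceq> z"
proof -
  \<comment> \<open>The right-hand side is \<open>\<one>\<close>; swapping then places
    \<open>x\<close> below \<open>z \<squnion> y\<close>, which is \<open>z\<close>.\<close>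
  have "z \<succ> y \<preceq> x \<succ> y"
    using assms(1) by (simp add: le_def G2)
  then have "x \<preceq> z \<squnion> y"
    unfolding join_def by (simp add: le_imp_swap)
  then show ?thesis
    using assms(2) by (simp add: le_iff_join join_commute)
qed

lemma imp_antimono: "x \<preceq> y \<Longrightarrow> y \<succ> z \<preceq> x \<succ> z"
  by (metis le_imp_swap le_trans join_upper1 join_def)

text \<open>Applying the antitone map \<open>u \<mapsto> u \<succ> y\<close> twice to
  \<open>x \<preceq> z\<close> gives
  \<open>x \<squnion> y \<preceq> z \<squnion> y = z\<close>.\<close>

lemma join_least:
  assumes "x \<preceq> z" and "y \<preceq> z"
  shows "x \<squnion> y \<preceq> z"
proof -
  have "x \<squnion> y \<preceq> z \<squnion> y"
    unfolding join_def using assms(1) by (intro imp_antimono)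
  then show ?thesis
    using assms(2) by (simp add: le_iff_join join_commute)
qed

end

context bounded_g_algebra
begin

text \<open>The double negation is \<open>x \<squnion> \<zero>\<close>.\<close>

lemma neg_neg: "\<sim> (\<sim> x) = x"
  using zero_least[of x] by (metis neg_def join_def join_commute le_iff_join)

lemma neg_antimono: "x \<preceq> y \<Longrightarrow> \<sim> y \<preceq> \<sim> x"
  unfolding neg_def by (rule imp_antimono)

lemma neg_join: "\<sim> (x \<squnion> y) = \<sim> x \<sqinter> \<sim> y"
  by (simp add: meet_def neg_neg)

lemma meet_lower1: "x \<sqinter> y \<preceq> x"
  by (metis meet_def neg_antimono neg_neg join_upper1)

lemma meet_lower2: "x \<sqinter> y \<preceq> y"
  by (metis meet_def neg_antimono neg_neg join_upper2)

lemma meet_greatest: "z \<preceq> x \<Longrightarrow> z \<preceq> y \<Longrightarrow> z \<preceq> x \<sqinter> y"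
  by (metis meet_def neg_antimono neg_neg join_least)

end

context distributive_bounded_g_algebra
begin

lemma meet_join_le: "(x \<squnion> z) \<sqinter> (y \<squnion> z) \<preceq> (x \<sqinter> y) \<squnion> z"
proof -
  let ?w = "(x \<squnion> z) \<sqinter> (y \<squnion> z)"
  \<comment> \<open>These are \<open>?w \<preceq> x \<squnion> z\<close> and
    \<open>?w \<preceq> y \<squnion> z\<close> with the two sides of the connection swapped.\<close>
  have "x \<succ> z \<preceq> ?w \<succ> z" "y \<succ> z \<preceq> ?w \<succ> z"
    using meet_lower1[of "x \<squnion> z" "y \<squnion> z"] meet_lower2[of "x \<squnion> z" "y \<squnion> z"]
    by (simp_all add: join_def le_imp_swap)
  then have "(x \<sqinter> y) \<succ> z \<preceq> ?w \<succ> z"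
    using distributive join_least le_trans by blast
  then show ?thesis
    unfolding join_def by (simp add: le_imp_swap)
qed

lemma join_meet_distrib: "x \<squnion> (y \<sqinter> z) = (x \<squnion> y) \<sqinter> (x \<squnion> z)"
proof (rule le_antisym)
  \<comment> \<open>This half holds in every lattice.\<close>
  show "x \<squnion> (y \<sqinter> z) \<preceq> (x \<squnion> y) \<sqinter> (x \<squnion> z)"
    by (meson join_least meet_greatest join_upper1 join_upper2 meet_lower1 meet_lower2 le_trans)
  show "(x \<squnion> y) \<sqinter> (x \<squnion> z) \<preceq> x \<squnion> (y \<sqinter> z)"
    using meet_join_le[of y x z] by (simp add: join_commute)
qed

lemma distrib_lattice:
  "class.distrib_lattice (\<sqinter>) (\<preceq>) (\<lambda>x y. x \<preceq> y \<and> x \<noteq> y) (\<squnion>)"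
proof
  show "x \<preceq> y \<Longrightarrow> y \<preceq> z \<Longrightarrow> x \<preceq> z" for x y z
    by (rule le_trans)
qed (auto intro: le_refl le_antisym meet_lower1 meet_lower2 meet_greatest
    join_upper1 join_upper2 join_least join_meet_distrib)

lemma order_top: "class.order_top (\<preceq>) (\<lambda>x y. x \<preceq> y \<and> x \<noteq> y) \<one>"
proof
  show "x \<preceq> y \<Longrightarrow> y \<preceq> z \<Longrightarrow> x \<preceq> z" for x y z
    by (rule le_trans)
qed (auto intro: le_refl le_antisym le_one)

end

theorem theorem2p8:
  fixes imp :: "'a \<Rightarrow> 'a \<Rightarrow> 'a" and one zero :: 'a
  assumes "distributive_bounded_g_algebra imp one zero"
  shows "de_morgan_algebra
    (g_algebra.join imp) (bounded_g_algebra.meet imp zero) (bounded_g_algebra.neg imp zero) one"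
proof -
  interpret distributive_bounded_g_algebra imp one zero
    by (rule assms)
  show ?thesis
    \<comment> \<open>\<open>le_iff_join\<close> identifies \<open>\<preceq>\<close> with the order
      induced by the join.\<close>
    using distrib_lattice order_top neg_neg neg_join
    by (simp add: de_morgan_algebra_def Let_def le_iff_join[abs_def])
qed

end
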